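(* Assume that $f(x)=\langle c,x\rangle$ for some $c\in\mathbb{R}^n$ and that the dynamical system $(H\text{-}SD)$ with initial condition $x^0\in\mathcal{F}$ is well-posed, with solution $x(t)$. Let $(\mu_k)_{k\ge0}$ be a sequence of positive real numbers. Then the viscosity optimal path $$\widetilde x(\varepsilon)\in\operatorname{Argmin}\{\langle c,x\rangle+\varepsilon D_h(x,x^0)\mid Ax=b\},\quad\varepsilon>0,$$ and the sequence $(x^k)$ generated from $x^0$ by $$x^{k+1}\in\operatorname{Argmin}\Big\{f(x)+\frac1{\mu_k}D_h(x,x^k)\;\Big|\;Ax=b\Big\},\quad k\ge0,$$ exist and are unique, and in addition $\widetilde x(\varepsilon)=x(1/\varepsilon)$ for all $\varepsilon>0$ and $x^k=x\big(\sum_{l=0}^{k-1}\mu_l\big)$ for all $k\ge1$.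
   Context: Let $m<n$ be positive integers, $A\in\mathbb{R}^{m\times n}$ of full rank, $b\in\operatorname{Im}A$, $\mathcal{A}=\{x\in\mathbb{R}^n: Ax=b\}$, $\mathcal{A}_0=\ker A$. Let $C\subset\mathbb{R}^n$ be nonempty, open and convex, with $\mathcal{F}=C\cap\mathcal{A}\neq\emptyset$. $\Gamma_0(\mathbb{R}^n)$ is the set of lower semicontinuous proper convex functions $\mathbb{R}^n\to\mathbb{R}\cup\{+\infty\}$. A function $h\in\Gamma_0(\mathbb{R}^n)$ is essentially smooth if it is differentiable on $\operatorname{int}\operatorname{dom}h$ and $|\nabla h(x^j)|\to+\infty$ for every sequence $(x^j)\subset\operatorname{int}\operatorname{dom}h$ converging to a boundary point of $\operatorname{dom}h$; it is of Legendre type if moreover it is strictly convex on $\operatorname{int}\operatorname{dom}h$. The function $h\in\Gamma_0(\mathbb{R}^n)$ is assumed to satisfy: (i) $h$ is of Legendre type with $\operatorname{int}\operatorname{dom}h=C$; (ii) $h_{|C}\in\mathcal{C}^2(C;\mathbb{R})$ and $\nabla^2h(x)$ is symmetric positive definite for all $x\in C$; (iii) $x\mapsto\nabla^2h(x)$ is locally Lipschitz continuous on $C$. Set $H=\nabla^2h$ on $C$. $D_h(x,y)=h(x)-h(y)-\langle\nabla h(y),x-y\rangle$ for $x\in\operatorname{dom}h$, $y\in C$ (the minimizations involving $D_h(x,\cdot)$ are over $x\in\operatorname{dom}h$). On $\mathcal{F}$, with tangent space $\mathcal{A}_0$, consider the Riemannian metric $(u,v)^H_x=\langle H(x)u,v\rangle$;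 the gradient of $f_{|\mathcal{F}}$ is $\nabla_Hf_{|\mathcal{F}}(x)=H(x)^{-1}[I-A^T(AH(x)^{-1}A^T)^{-1}AH(x)^{-1}]\nabla f(x)$. $(H\text{-}SD)$ is the Cauchy problem $\dot x(t)+\nabla_Hf_{|\mathcal{F}}(x(t))=0$, $x(0)=x^0\in\mathcal{F}$, with maximal solution defined on $(T_m,T_M)$; it is well-posed if $T_M=+\infty$. *)

theory Defs
  imports "HOL-Analysis.Analysis"
begin

text \<open>Both are meaningful only where the function is (twice) differentiable.\<close>

definition gradient :: "('a::real_inner \<Rightarrow> real) \<Rightarrow> 'a \<Rightarrow> 'a" where
  "gradient f x = (THE D. GDERIV f x :> D)"

definition hessian :: "(real^'n \<Rightarrow> real) \<Rightarrow> real^'n \<Rightarrow> real^'n^'n" where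
  "hessian f x = matrix (frechet_derivative (gradient f) (at x))"

definition C2_on :: "(real^'n) set \<Rightarrow> (real^'n \<Rightarrow> real) \<Rightarrow> bool" where
  "C2_on S f \<longleftrightarrow>
     (\<forall>x\<in>S. f differentiable (at x) \<and> gradient f differentiable (at x)) \<and>
     continuous_on S (hessian f)"

definition sym_pos_def :: "real^'n^'n \<Rightarrow> bool" where
  "sym_pos_def M \<longleftrightarrow> transpose M = M \<and> (\<forall>u. u \<noteq> 0 \<longrightarrow> (M *v u) \<bullet> u > 0)"

definition locally_lipschitz_on ::
    "'a::metric_space set \<Rightarrow> ('a \<Rightarrow> 'b::metric_space) \<Rightarrow> bool" where
  "locally_lipschitz_on S g \<longleftrightarrow> (\<forall>x\<in>S. \<exists>e>0. \<exists>L. L-lipschitz_on (ball x e \<inter> S) g)"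

definition effdom :: "('a \<Rightarrow> ereal) \<Rightarrow> 'a set" where
  "effdom h = {x. h x < \<infinity>}"

text \<open>The finite part of \<open>h\<close>; it takes the junk value 0 outside \<open>effdom h\<close>.\<close>

abbreviation fin :: "('a \<Rightarrow> ereal) \<Rightarrow> 'a \<Rightarrow> real" where
  "fin h \<equiv> \<lambda>x. real_of_ereal (h x)"

definition proper :: "('a \<Rightarrow> ereal) \<Rightarrow> bool" where
  "proper h \<longleftrightarrow> (\<forall>x. h x \<noteq> -\<infinity>) \<and> effdom h \<noteq> {}"

definition ext_convex :: "('a::real_vector \<Rightarrow> ereal) \<Rightarrow> bool" where
  "ext_convex h \<longleftrightarrow>
     (\<forall>x y. \<forall>u\<ge>0. \<forall>v\<ge>0. u + v = 1 \<longrightarrow>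
        h (u *\<^sub>R x + v *\<^sub>R y) \<le> ereal u * h x + ereal v * h y)"

definition lower_semicontinuous :: "('a::topological_space \<Rightarrow> ereal) \<Rightarrow> bool" where
  "lower_semicontinuous h \<longleftrightarrow> (\<forall>x. h x \<le> Liminf (at x) h)"

definition Gamma0 :: "('a::real_normed_vector \<Rightarrow> ereal) set" where
  "Gamma0 = {h. lower_semicontinuous h \<and> proper h \<and> ext_convex h}"

definition essentially_smooth :: "('a::real_inner \<Rightarrow> ereal) \<Rightarrow> bool" where
  "essentially_smooth h \<longleftrightarrow>
     (\<forall>x\<in>interior (effdom h). fin h differentiable (at x)) \<and>
     (\<forall>s z. (\<forall>j::nat. s j \<in> interior (effdom h)) \<and> s \<longlonglongrightarrow> z \<and> z \<in> frontier (effdom h) \<longrightarrow>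
        filterlim (\<lambda>j. norm (gradient (fin h) (s j))) at_top sequentially)"

definition strictly_convex_on :: "'a::real_vector set \<Rightarrow> ('a \<Rightarrow> real) \<Rightarrow> bool" where
  "strictly_convex_on S f \<longleftrightarrow> convex S \<and>
     (\<forall>x\<in>S. \<forall>y\<in>S. \<forall>u>0. \<forall>v>0. x \<noteq> y \<and> u + v = 1 \<longrightarrow>
        f (u *\<^sub>R x + v *\<^sub>R y) < u * f x + v * f y)"

definition legendre_type :: "('a::real_inner \<Rightarrow> ereal) \<Rightarrow> bool" where
  "legendre_type h \<longleftrightarrow> essentially_smooth h \<and> strictly_convex_on (interior (effdom h)) (fin h)"

text \<open>Meaningful for \<open>x \<in> effdom h\<close> and \<open>y \<in> interior (effdom h)\<close>.\<close>

definition bregman :: "('a::real_inner \<Rightarrow> ereal) \<Rightarrow> 'a \<Rightarrow> 'a \<Rightarrow> real" where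
  "bregman h x y = fin h x - fin h y - gradient (fin h) y \<bullet> (x - y)"

definition affine_space :: "real^'n^'m \<Rightarrow> real^'m \<Rightarrow> (real^'n) set" where
  "affine_space A b = {x. A *v x = b}"

definition riemannian_gradient ::
    "(real^'n \<Rightarrow> ereal) \<Rightarrow> real^'n^'m \<Rightarrow> (real^'n \<Rightarrow> real) \<Rightarrow> real^'n \<Rightarrow> real^'n" where
  "riemannian_gradient h A f x =
     (let Hinv = matrix_inv (hessian (fin h) x) in
      (Hinv ** (mat 1 - transpose A ** matrix_inv (A ** Hinv ** transpose A) ** A ** Hinv))
        *v gradient f x)"

lemma matrix_inv_apply:
  fixes M :: "real^'n^'n"
  assumes "inj ((*v) M)"
  shows "M *v (matrix_inv M *v y) = y"
proof -
  have "invertible M"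
    using assms by (metis invertible_left_inverse matrix_left_invertible_injective)
  then have "M ** matrix_inv M = mat 1"
    unfolding invertible_def matrix_inv_def by (rule someI2_ex) simp
  then show ?thesis
    by (simp add: matrix_vector_mul_assoc)
qed

text \<open>This vector is the gradient of \<open>f\<close> restricted to the affine space, for the metric
  \<open>(u, v) \<mapsto> (H x *v u) \<bullet> v\<close> on the tangent space \<open>ker A\<close>.\<close>

lemma riemannian_gradient_unique:
  fixes A :: "real^'n^'m"
  assumes H: "sym_pos_def (hessian (fin h) x)" and A: "rank A = CARD('m)"
  shows "g = riemannian_gradient h A f x \<longleftrightarrow>
    A *v g = 0 \<and> (\<forall>u. A *v u = 0 \<longrightarrow> (hessian (fin h) x *v g) \<bullet> u = gradient f x \<bullet> u)"
proof -
  define H where "H = hessian (fin h) x"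
  define Hi where "Hi = matrix_inv H"
  define M where "M = A ** Hi ** transpose A"
  define d where "d = gradient f x"
  define w where "w = matrix_inv M *v (A *v (Hi *v d))"
  define r where "r = riemannian_gradient h A f x"
  have pd: "u \<noteq> 0 \<Longrightarrow> (H *v u) \<bullet> u > 0" for u
    using H by (simp add: sym_pos_def_def H_def)
  have injH: "inj ((*v) H)"
    by (rule injI) (metis pd eq_iff_diff_eq_0 inner_zero_left less_irrefl matrix_vector_mult_diff_distrib)
  then have HHi: "H *v (Hi *v y) = y" for y
    by (simp add: Hi_def matrix_inv_apply)
  have injAT: "inj ((*v) (transpose A))"
    using A by (metis full_rank_injective rank_transpose)
  have MMv: "M *v y = A *v (Hi *v (transpose A *v y))" for y
    by (simp add: M_def matrix_vector_mul_assoc matrix_mul_assoc del: transpose_matrix_vector)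
  have M0: "y = 0" if "M *v y = 0" for y
  proof -
    define z where "z = Hi *v (transpose A *v y)"
    have "(H *v z) \<bullet> z = (transpose A *v y) \<bullet> z" by (simp add: z_def HHi del: transpose_matrix_vector)
    also have "\<dots> = y \<bullet> (A *v z)" by (simp add: dot_lmul_matrix)
    also have "\<dots> = 0" using that by (simp add: MMv z_def del: transpose_matrix_vector)
    finally have "z = 0" using pd[of z] by (cases "z = 0") auto
    then have "transpose A *v y = 0" using HHi[of "transpose A *v y"] by (simp add: z_def del: transpose_matrix_vector)
    then show "y = 0" using injAT by (metis injD matrix_vector_mult_0_right)
  qed
  have "inj ((*v) M)"
  proof (rule injI)
    fix y z assume "M *v y = M *v z"
    then show "y = z" using M0[of "y - z"] by (simp add: matrix_vector_mult_diff_distrib)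
  qed
  then have MMi: "M *v (matrix_inv M *v y) = y" for y
    by (rule matrix_inv_apply)
  have r: "r = Hi *v (d - transpose A *v w)"
    by (simp add: r_def riemannian_gradient_def Let_def w_def d_def M_def Hi_def H_def
        matrix_vector_mul_assoc[symmetric] matrix_vector_mult_diff_rdistrib
        del: transpose_matrix_vector)
  have Ar: "A *v r = 0"
    using MMi[of "A *v (Hi *v d)"]
    by (simp add: r MMv matrix_vector_mult_diff_distrib w_def del: transpose_matrix_vector)
  have "(transpose A *v w) \<bullet> u = w \<bullet> (A *v u)" for u
    by (simp add: dot_lmul_matrix)
  then have Hr: "(H *v r) \<bullet> u = d \<bullet> u" if "A *v u = 0" for u
    using that by (simp add: r HHi inner_diff_left)
  have "g = r" if g: "A *v g = 0" "\<forall>u. A *v u = 0 \<longrightarrow> (H *v g) \<bullet> u = d \<bullet> u"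
  proof -
    have "A *v (g - r) = 0" using g Ar by (simp add: matrix_vector_mult_diff_distrib)
    then have "(H *v (g - r)) \<bullet> (g - r) = 0"
      using g(2) Hr by (simp add: matrix_vector_mult_diff_distrib inner_diff_left)
    then show ?thesis using pd[of "g - r"] by (cases "g = r") auto
  qed
  then show ?thesis
    using Ar Hr unfolding r_def H_def d_def by blast
qed

definition HSD_solution ::
    "(real^'n \<Rightarrow> ereal) \<Rightarrow> real^'n^'m \<Rightarrow> real^'m \<Rightarrow> (real^'n \<Rightarrow> real) \<Rightarrow> real^'n
      \<Rightarrow> ereal \<Rightarrow> ereal \<Rightarrow> (real \<Rightarrow> real^'n) \<Rightarrow> bool" where
  "HSD_solution h A b f x0 T1 T2 x \<longleftrightarrow>
     T1 < 0 \<and> 0 < T2 \<and> x 0 = x0 \<and>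
     (\<forall>t. T1 < ereal t \<and> ereal t < T2 \<longrightarrow>
        x t \<in> interior (effdom h) \<inter> affine_space A b \<and>
        (x has_vector_derivative - riemannian_gradient h A f (x t)) (at t))"

text \<open>The values of \<open>x\<close> outside the open interval \<open>(T1, T2)\<close> are irrelevant.\<close>

definition maximal_HSD_solution ::
    "(real^'n \<Rightarrow> ereal) \<Rightarrow> real^'n^'m \<Rightarrow> real^'m \<Rightarrow> (real^'n \<Rightarrow> real) \<Rightarrow> real^'n
      \<Rightarrow> ereal \<Rightarrow> ereal \<Rightarrow> (real \<Rightarrow> real^'n) \<Rightarrow> bool" where
  "maximal_HSD_solution h A b f x0 T1 T2 x \<longleftrightarrow>
     HSD_solution h A b f x0 T1 T2 x \<and>
     (\<forall>S1 S2 y. S1 \<le> T1 \<and> T2 \<le> S2 \<and> HSD_solution h A b f x0 S1 S2 y \<and>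
        (\<forall>t. T1 < ereal t \<and> ereal t < T2 \<longrightarrow> y t = x t) \<longrightarrow> S1 = T1 \<and> S2 = T2)"

definition viscosity_argmin ::
    "(real^'n \<Rightarrow> ereal) \<Rightarrow> real^'n^'m \<Rightarrow> real^'m \<Rightarrow> real^'n \<Rightarrow> real^'n \<Rightarrow> real
      \<Rightarrow> (real^'n) set" where
  "viscosity_argmin h A b c x0 \<epsilon> =
     {y. is_arg_min (\<lambda>x. c \<bullet> x + \<epsilon> * bregman h x x0) (\<lambda>x. x \<in> effdom h \<and> A *v x = b) y}"

definition prox_argmin ::
    "(real^'n \<Rightarrow> ereal) \<Rightarrow> real^'n^'m \<Rightarrow> real^'m \<Rightarrow> (real^'n \<Rightarrow> real) \<Rightarrow> real \<Rightarrow> real^'n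
      \<Rightarrow> (real^'n) set" where
  "prox_argmin h A b f \<mu> y =
     {z. is_arg_min (\<lambda>x. f x + (1 / \<mu>) * bregman h x y) (\<lambda>x. x \<in> effdom h \<and> A *v x = b) z}"

text \<open>Membership of \<open>xs k\<close> in \<open>interior (effdom h)\<close>, where \<open>bregman h _ (xs k)\<close> is meaningful, is not
  imposed; it holds at \<open>k = 0\<close> and propagates when each minimizer lies there.\<close>

definition prox_sequence ::
    "(real^'n \<Rightarrow> ereal) \<Rightarrow> real^'n^'m \<Rightarrow> real^'m \<Rightarrow> (real^'n \<Rightarrow> real) \<Rightarrow> (nat \<Rightarrow> real)
      \<Rightarrow> real^'n \<Rightarrow> (nat \<Rightarrow> real^'n) \<Rightarrow> bool" where
  "prox_sequence h A b f \<mu> x0 xs \<longleftrightarrow>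
     xs 0 = x0 \<and> (\<forall>k. xs (Suc k) \<in> prox_argmin h A b f (\<mu> k) (xs k))"

end

theory Submission
  imports Defs
begin

text \<open>Along a trajectory, \<open>\<nabla>h(x(t)) + t c\<close> has a constant pairing with every \<open>u\<close> in the kernel of
  \<open>A\<close>, because \<open>H(x) x'\<close> and \<open>-c\<close> have the same pairing with \<open>u\<close>. Hence \<open>x(s + \<delta>)\<close> satisfies the
  first order condition of the minimization of \<open>\<langle>c, z\<rangle> + D\<^sub>h(z, x(s)) / \<delta>\<close> subject to \<open>A z = b\<close>, and
  the objective at \<open>z\<close> exceeds its value at \<open>x(s + \<delta>)\<close> by exactly \<open>D\<^sub>h(z, x(s + \<delta>)) / \<delta>\<close>, which is
  positive unless \<open>z = x(s + \<delta>)\<close>. The viscosity path is the case \<open>s = 0\<close>; the proximal sequence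
  follows by induction.\<close>

section \<open>Gradients and Hessians as derivatives\<close>

lemma gradient_eqI:
  assumes "GDERIV f x :> D"
  shows "gradient f x = D"
proof -
  have "D' = D" if "GDERIV f x :> D'" for D'
  proof -
    have "(\<lambda>v. v \<bullet> D') = (\<lambda>v. v \<bullet> D)"
      using assms that unfolding gderiv_def by (rule has_derivative_unique[rotated])
    then show ?thesis
      by (metis vector_eq_ldot)
  qed
  then show ?thesis
    unfolding gradient_def using assms by (rule the_equality[rotated])
qed

lemma GDERIV_gradient:
  fixes f :: "'a::euclidean_space \<Rightarrow> real"
  assumes "f differentiable (at x)"
  shows "GDERIV f x :> gradient f x"
proof -
  obtain f' where f': "(f has_derivative f') (at x)"
    using assms by (auto simp: differentiable_def)
  then have "linear f'"
    by (rule has_derivative_linear)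
  \<comment> \<open>Riesz representation: \<open>f' v\<close> equals \<open>f' v * 1\<close>, the
    inner product on the reals, and moving \<open>f'\<close> across it yields the representing
    vector.\<close>
  then have "f' = (\<lambda>v. v \<bullet> adjoint f' 1)"
    by (simp add: adjoint_works)
  then have "GDERIV f x :> adjoint f' 1"
    using f' by (simp add: gderiv_def)
  then show ?thesis
    by (simp add: gradient_eqI)
qed

lemma has_derivative_gradient_hessian:
  fixes f :: "real^'n \<Rightarrow> real"
  assumes "gradient f differentiable (at x)"
  shows "(gradient f has_derivative (*v) (hessian f x)) (at x)"
proof -
  have D: "(gradient f has_derivative frechet_derivative (gradient f) (at x)) (at x)"
    using assms by (simp add: frechet_derivative_works)
  then have "(*v) (hessian f x) = frechet_derivative (gradient f) (at x)"
    unfolding hessian_def by (simp add: has_derivative_linear matrix_works fun_eq_iff)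
  with D show ?thesis by simp
qed

section \<open>Convexity of the finite part and the sign of the Bregman distance\<close>

lemma ereal_fin:
  assumes "proper h" "z \<in> effdom h"
  shows "h z = ereal (fin h z)"
  using assms by (cases "h z") (auto simp: proper_def effdom_def)

text \<open>Finite values at both endpoints make the extended-real convexity bound finite, which
  keeps the intermediate point in the domain. Writing that point as base plus step suits difference
  quotients at \<open>y\<close>.\<close>

lemma fin_convex:
  assumes "proper h" "ext_convex h" "y \<in> effdom h" "z \<in> effdom h" "0 \<le> s" "s \<le> 1"
  shows "y + s *\<^sub>R (z - y) \<in> effdom h"
    and "fin h (y + s *\<^sub>R (z - y)) \<le> fin h y + s * (fin h z - fin h y)"
proof -
  let ?p = "y + s *\<^sub>R (z - y)"
  have p: "?p = (1 - s) *\<^sub>R y + s *\<^sub>R z"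
    by (simp add: algebra_simps)
  have "h ?p \<le> ereal (1 - s) * h y + ereal s * h z"
    unfolding p using assms(2,5,6) unfolding ext_convex_def by simp
  also have "\<dots> = ereal (fin h y + s * (fin h z - fin h y))"
    by (subst ereal_fin[OF assms(1,3)], subst ereal_fin[OF assms(1,4)]) (simp add: algebra_simps)
  finally have le: "h ?p \<le> ereal (fin h y + s * (fin h z - fin h y))" .
  then show p_dom: "?p \<in> effdom h"
    unfolding effdom_def using less_ereal.simps(4) le_less_trans by blast
  then have "h ?p = ereal (fin h ?p)"
    using assms(1) by (intro ereal_fin)
  with le show "fin h ?p \<le> fin h y + s * (fin h z - fin h y)"
    by (metis ereal_less_eq(3))
qed

text \<open>This is the gradient inequality: convexity bounds the difference quotients from
  \<open>y\<close> towards \<open>z\<close> by \<open>fin h z - fin h y\<close>, and they tend to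
  the directional derivative at \<open>y\<close>.\<close>

lemma bregman_nonneg:
  fixes h :: "'a::euclidean_space \<Rightarrow> ereal"
  assumes "proper h" "ext_convex h" "y \<in> effdom h" "z \<in> effdom h"
    and diff: "fin h differentiable (at y)"
  shows "0 \<le> bregman h z y"
proof -
  let ?\<phi> = "\<lambda>s. fin h (y + s *\<^sub>R (z - y))"
  have "(fin h has_derivative (\<lambda>v. v \<bullet> gradient (fin h) y)) (at (y + 0 *\<^sub>R (z - y)))"
    using GDERIV_gradient[OF diff] by (simp add: gderiv_def)
  moreover have "((\<lambda>s. y + s *\<^sub>R (z - y)) has_derivative (\<lambda>s. s *\<^sub>R (z - y))) (at 0)"
    by (auto intro!: derivative_eq_intros)
  ultimately have "(?\<phi> has_derivative (\<lambda>s. (s *\<^sub>R (z - y)) \<bullet> gradient (fin h) y)) (at 0)"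
    by (rule has_derivative_compose[rotated])
  moreover have "(\<lambda>s. (s *\<^sub>R (z - y)) \<bullet> gradient (fin h) y) = (*) ((z - y) \<bullet> gradient (fin h) y)"
    by (simp add: fun_eq_iff)
  ultimately have "(?\<phi> has_field_derivative (z - y) \<bullet> gradient (fin h) y) (at 0)"
    by (simp only: has_field_derivative_def)
  then have "((\<lambda>s. (?\<phi> s - ?\<phi> 0) / s) \<longlongrightarrow> (z - y) \<bullet> gradient (fin h) y) (at 0)"
    unfolding DERIV_def by (simp only: add_0)
  \<comment> \<open>The limit is restricted to the right because convexity on the segment controls
    the quotient only for \<open>0 < s < 1\<close>.\<close>
  then have "((\<lambda>s. (?\<phi> s - ?\<phi> 0) / s) \<longlongrightarrow> (z - y) \<bullet> gradient (fin h) y) (at_right 0)"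
    by (rule filterlim_mono[OF _ order_refl at_le[OF subset_UNIV]])
  moreover have "\<forall>\<^sub>F s in at_right 0. (?\<phi> s - ?\<phi> 0) / s \<le> fin h z - fin h y"
    unfolding eventually_at_right_field
  proof (intro exI[of _ 1] conjI allI impI)
    fix s :: real
    assume "0 < s" "s < 1"
    then show "(?\<phi> s - ?\<phi> 0) / s \<le> fin h z - fin h y"
      using fin_convex(2)[OF assms(1-4), of s] by (simp add: field_simps)
  qed simp
  ultimately have "(z - y) \<bullet> gradient (fin h) y \<le> fin h z - fin h y"
    by (rule tendsto_upperbound) simp
  then show ?thesis
    by (simp add: bregman_def inner_commute)
qed

text \<open>Strict convexity applies on a short initial piece of the segment from \<open>y\<close>
  to \<open>z\<close>; plain convexity carries the strict gap on to \<open>z\<close>.\<close>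

lemma bregman_pos:
  fixes h :: "'a::euclidean_space \<Rightarrow> ereal"
  assumes h: "proper h" "ext_convex h"
    and strict: "strictly_convex_on (interior (effdom h)) (fin h)"
    and y: "y \<in> interior (effdom h)" and z: "z \<in> effdom h" "z \<noteq> y"
    and diff: "fin h differentiable (at y)"
  shows "0 < bregman h z y"
proof -
  have y': "y \<in> effdom h"
    using y interior_subset by blast
  obtain e where e: "e > 0" "ball y e \<subseteq> interior (effdom h)"
    using y open_interior open_contains_ball by blast
  \<comment> \<open>As \<open>z\<close> may lie on the boundary of the domain, strictness is only available near \<open>y\<close>.\<close>
  define s where "s = min 1 (e / (2 * norm (z - y)))"
  have s: "0 < s" "s \<le> 1"
    using e z by (auto simp: s_def)
  have "s * norm (z - y) \<le> e / (2 * norm (z - y)) * norm (z - y)"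
    unfolding s_def by (intro mult_right_mono) auto
  also have "\<dots> < e"
    using e z by simp
  finally have "s * norm (z - y) < e" .
  define p where "p = y + s *\<^sub>R (z - y)"
  have p: "p \<in> interior (effdom h)"
    using \<open>s * norm (z - y) < e\<close> s e(2) by (auto simp: p_def dist_norm subset_iff)
  have "p \<noteq> y"
    using s z by (simp add: p_def)
  have hp: "fin h p \<le> fin h y + s * (fin h z - fin h y)"
    unfolding p_def using h y' z s by (intro fin_convex(2)) auto
  define q where "q = (1/2) *\<^sub>R p + (1/2) *\<^sub>R y"
  have q_eq: "q = y + (s / 2) *\<^sub>R (z - y)"
    by (simp add: q_def p_def algebra_simps flip: scaleR_add_left)
  have "fin h q < 1/2 * fin h p + 1/2 * fin h y"
  proof -
    have "p \<noteq> y \<and> u + v = 1 \<longrightarrow>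
        fin h (u *\<^sub>R p + v *\<^sub>R y) < u * fin h p + v * fin h y" if "u > 0" "v > 0" for u v
      using strict p y that unfolding strictly_convex_on_def by blast
    from this[of "1/2" "1/2"] show ?thesis
      using \<open>p \<noteq> y\<close> by (simp add: q_def)
  qed
  moreover have "q \<in> effdom h"
    unfolding q_eq using h y' z s by (intro fin_convex(1)) auto
  then have "0 \<le> bregman h q y"
    using bregman_nonneg[OF h y' _ diff] by simp
  \<comment> \<open>The chain is: the left side is at most \<open>fin h q - fin h y\<close> by
    nonnegativity at \<open>q\<close>, which is below half of \<open>fin h p - fin h y\<close> by
    strictness, which is at most the right side by \<open>hp\<close>.\<close>
  ultimately have "s / 2 * (gradient (fin h) y \<bullet> (z - y)) < s / 2 * (fin h z - fin h y)"
    using hp by (simp add: bregman_def q_eq)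
  then show ?thesis
    using s by (simp add: bregman_def)
qed

section \<open>Trajectories and proximal steps\<close>

lemma HSD_first_order:
  fixes A :: "real^'n^'m"
  assumes rank: "rank A = CARD('m)"
    and smooth: "\<And>y. y \<in> interior (effdom h) \<Longrightarrow> gradient (fin h) differentiable (at y)"
    and spd: "\<And>y. y \<in> interior (effdom h) \<Longrightarrow> sym_pos_def (hessian (fin h) y)"
    and sol: "HSD_solution h A b (\<lambda>y. c \<bullet> y) x0 T1 \<infinity> x"
    and s: "0 \<le> s" and t: "0 \<le> t" and u: "A *v u = 0"
  shows "(gradient (fin h) (x t) - gradient (fin h) (x s)) \<bullet> u = (s - t) * (c \<bullet> u)"
proof -
  let ?g = "gradient (fin h)"
  define \<phi> where "\<phi> r = ?g (x r) \<bullet> u + r * (c \<bullet> u)" for r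
  have c: "gradient (\<lambda>y. c \<bullet> y) y = c" for y
    by (rule gradient_eqI) (auto simp: gderiv_def inner_commute intro!: derivative_eq_intros)
  \<comment> \<open>The half-line of nonnegative times lies in the interval of existence and is
    convex, so a vanishing derivative there forces \<open>\<phi>\<close> to be constant.\<close>
  have "(\<phi> has_field_derivative 0) (at r within {0..})" if "0 \<le> r" for r
  proof -
    have "T1 < ereal r"
      using sol that unfolding HSD_solution_def
      by (metis ereal_less_eq(5) order_less_le_trans)
    then have int: "x r \<in> interior (effdom h)"
      and x': "(x has_vector_derivative - riemannian_gradient h A (\<lambda>y. c \<bullet> y) (x r)) (at r)"
      using sol unfolding HSD_solution_def by auto
    let ?r = "riemannian_gradient h A (\<lambda>y. c \<bullet> y) (x r)"
    \<comment> \<open>The matrix formula for the Riemannian gradient is replaced by its variational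
      characterization, tested against \<open>u\<close> in the kernel of \<open>A\<close>.\<close>
    have Hr: "(hessian (fin h) (x r) *v ?r) \<bullet> u = c \<bullet> u"
      using riemannian_gradient_unique[where g = ?r and h = h and x = "x r" and A = A
          and f = "\<lambda>y. c \<bullet> y"] spd[OF int] rank u c by auto
    have "((\<lambda>r. ?g (x r)) has_derivative
        (\<lambda>v. hessian (fin h) (x r) *v (v *\<^sub>R - ?r))) (at r)"
      using has_derivative_compose[OF x'[unfolded has_vector_derivative_def]
          has_derivative_gradient_hessian[OF smooth[OF int]]] .
    then have "(\<phi> has_derivative (\<lambda>v. (hessian (fin h) (x r) *v (v *\<^sub>R - ?r)) \<bullet> u + v * (c \<bullet> u))) (at r)"
      unfolding \<phi>_def by (auto intro!: derivative_eq_intros)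
    moreover have "(hessian (fin h) (x r) *v (v *\<^sub>R - ?r)) \<bullet> u = - v * (c \<bullet> u)" for v
      using Hr by (metis inner_scaleR_left matrix_vector_mult_scaleR scaleR_minus_left scaleR_minus_right)
    ultimately have "(\<phi> has_derivative (\<lambda>v. 0 * v)) (at r)"
      by simp
    then show ?thesis
      unfolding has_field_derivative_def by (rule has_derivative_at_withinI)
  qed
  then have "\<exists>k. \<forall>r\<in>{0..}. \<phi> r = k"
    by (intro has_field_derivative_zero_constant) auto
  then have "\<phi> t = \<phi> s"
    using s t by auto
  then show ?thesis
    by (simp add: \<phi>_def inner_diff_left left_diff_distrib)
qed

text \<open>A proximal step with parameter \<open>\<delta>\<close> is the flow for time
  \<open>\<delta>\<close>. The trajectory itself exhibits the minimizer, which settles existence;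
  uniqueness comes from \<open>bregman_pos\<close>, also against competitors on the boundary of the
  domain.\<close>

lemma prox_argmin_HSD:
  fixes A :: "real^'n^'m"
  assumes rank: "rank A = CARD('m)"
    and h: "proper h" "ext_convex h" "strictly_convex_on (interior (effdom h)) (fin h)"
    and diff: "\<And>y. y \<in> interior (effdom h) \<Longrightarrow> fin h differentiable (at y)"
    and smooth: "\<And>y. y \<in> interior (effdom h) \<Longrightarrow> gradient (fin h) differentiable (at y)"
    and spd: "\<And>y. y \<in> interior (effdom h) \<Longrightarrow> sym_pos_def (hessian (fin h) y)"
    and sol: "HSD_solution h A b (\<lambda>y. c \<bullet> y) x0 T1 \<infinity> x"
    and s: "0 \<le> s" and \<delta>: "0 < \<delta>"
  shows "prox_argmin h A b (\<lambda>y. c \<bullet> y) \<delta> (x s) = {x (s + \<delta>)}"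
proof -
  let ?g = "gradient (fin h)"
  let ?F = "\<lambda>z. c \<bullet> z + (1 / \<delta>) * bregman h z (x s)"
  define y where "y = x (s + \<delta>)"
  have "T1 < ereal (s + \<delta>)"
    using sol s \<delta> unfolding HSD_solution_def
    by (metis add_nonneg_nonneg ereal_less_eq(5) less_imp_le order_less_le_trans)
  then have y: "y \<in> interior (effdom h)" "A *v y = b"
    using sol unfolding HSD_solution_def y_def affine_space_def by auto
  have y_dom: "y \<in> effdom h"
    using y interior_subset by blast
  have F: "?F z - ?F y = bregman h z y / \<delta>" if "A *v z = b" for z
  proof -
    have "(?g y - ?g (x s)) \<bullet> (z - y) = (s - (s + \<delta>)) * (c \<bullet> (z - y))"
      unfolding y_def
      by (rule HSD_first_order[OF rank smooth spd sol])
        (use s \<delta> that y in \<open>auto simp: y_def matrix_vector_mult_diff_distrib\<close>)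
    then have "c \<bullet> (z - y) = (?g (x s) \<bullet> (z - y) - ?g y \<bullet> (z - y)) / \<delta>"
      using \<delta> by (simp add: inner_diff_left field_simps)
    moreover have "?F z - ?F y = c \<bullet> (z - y) + (bregman h z (x s) - bregman h y (x s)) / \<delta>"
      by (simp add: inner_diff_right diff_divide_distrib)
    \<comment> \<open>Three-point identity for Bregman distances; its gradient terms cancel against
      the expression for \<open>c \<bullet> (z - y)\<close>.\<close>
    moreover have "bregman h z (x s) - bregman h y (x s) =
        bregman h z y + ?g y \<bullet> (z - y) - ?g (x s) \<bullet> (z - y)"
      by (simp add: bregman_def inner_diff_right)
    ultimately show ?thesis
      by (simp add: add_divide_distrib diff_divide_distrib)
  qed
  have lt: "?F y < ?F z" if "z \<in> effdom h" "A *v z = b" "z \<noteq> y" for z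
  proof -
    have "0 < bregman h z y / \<delta>"
      using bregman_pos[OF h y(1) that(1,3) diff[OF y(1)]] \<delta> by simp
    with F[OF that(2)] show ?thesis by linarith
  qed
  have "is_arg_min ?F (\<lambda>z. z \<in> effdom h \<and> A *v z = b) w \<longleftrightarrow> w = y" for w
    unfolding is_arg_min_def using lt y_dom y(2) by (metis less_asym)
  then show ?thesis
    unfolding prox_argmin_def y_def[symmetric] by (intro set_eqI) (simp only: mem_Collect_eq singleton_iff)
qed

text \<open>The viscosity point is one proximal step from \<open>x0\<close> with parameter
  \<open>1 / \<epsilon>\<close>. The convention \<open>1 / 0 = 0\<close> makes this hold for
  \<open>\<epsilon> = 0\<close> as well.\<close>

lemma viscosity_argmin_eq_prox_argmin:
  "viscosity_argmin h A b c x0 \<epsilon> = prox_argmin h A b (\<lambda>y. c \<bullet> y) (1 / \<epsilon>) x0"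
  by (simp add: viscosity_argmin_def prox_argmin_def)

theorem proposition3p2:
  fixes A :: "real^'n^'m" and b :: "real^'m" and C :: "(real^'n) set"
    and h :: "real^'n \<Rightarrow> ereal" and f :: "real^'n \<Rightarrow> real" and c x0 :: "real^'n"
    and x :: "real \<Rightarrow> real^'n" and T_m T_M :: ereal and \<mu> :: "nat \<Rightarrow> real"
  assumes "CARD('m) < CARD('n)"
    and "rank A = CARD('m)"
    and "b \<in> range ((*v) A)"
    and "C \<noteq> {}" and "open C" and "convex C"
    and "C \<inter> affine_space A b \<noteq> {}"
    and "h \<in> Gamma0"
    and "legendre_type h" and "interior (effdom h) = C"
    and "C2_on C (fin h)" and "\<forall>y\<in>C. sym_pos_def (hessian (fin h) y)"
    and "locally_lipschitz_on C (hessian (fin h))"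
    and "\<forall>y. f y = c \<bullet> y"
    and "x0 \<in> C \<inter> affine_space A b"
    and "maximal_HSD_solution h A b f x0 T_m T_M x"
    and "T_M = \<infinity>"
    and "\<forall>k. \<mu> k > 0"
  shows "(\<forall>\<epsilon>>0. \<exists>!y. y \<in> viscosity_argmin h A b c x0 \<epsilon>)
    \<and> (\<exists>!xs. prox_sequence h A b f \<mu> x0 xs)
    \<and> (\<forall>\<epsilon>>0. \<forall>y \<in> viscosity_argmin h A b c x0 \<epsilon>. y = x (1 / \<epsilon>))
    \<and> (\<forall>xs. prox_sequence h A b f \<mu> x0 xs \<longrightarrow>
          (\<forall>k. \<exists>!y. y \<in> prox_argmin h A b f (\<mu> k) (xs k))
          \<and> (\<forall>k\<ge>1. xs k = x (\<Sum>l<k. \<mu> l)))"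
proof -
  have f: "f = (\<lambda>y. c \<bullet> y)"
    using assms(14) by auto
  have sol: "HSD_solution h A b (\<lambda>y. c \<bullet> y) x0 T_m \<infinity> x"
    using assms(16,17) unfolding maximal_HSD_solution_def f by simp
  have step: "prox_argmin h A b f \<delta> (x s) = {x (s + \<delta>)}" if "0 \<le> s" "0 < \<delta>" for s \<delta>
    unfolding f
    by (rule prox_argmin_HSD[OF assms(2) _ _ _ _ _ _ sol that])
      (use assms(8-12) in \<open>auto simp: Gamma0_def legendre_type_def C2_on_def\<close>)
  have x0: "x 0 = x0"
    using sol by (simp add: HSD_solution_def)
  have visc: "viscosity_argmin h A b c x0 \<epsilon> = {x (1 / \<epsilon>)}" if "0 < \<epsilon>" for \<epsilon>
    using step[of 0 "1 / \<epsilon>"] that by (simp add: viscosity_argmin_eq_prox_argmin f x0)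
  \<comment> \<open>The trajectory sampled at the accumulated step sizes; the empty sum makes
    \<open>X 0\<close> the starting point.\<close>
  define X where "X k = x (\<Sum>l<k. \<mu> l)" for k
  have prox: "prox_argmin h A b f (\<mu> k) (X k) = {X (Suc k)}" for k
    unfolding X_def using step[of "\<Sum>l<k. \<mu> l" "\<mu> k"] assms(18)
    by (simp add: sum_nonneg less_imp_le)
  have X: "prox_sequence h A b f \<mu> x0 X"
    using prox by (simp add: prox_sequence_def X_def x0)
  \<comment> \<open>Each argmin set along \<open>X\<close> is a singleton, so induction leaves no
    choice at any step.\<close>
  have uniq: "xs = X" if "prox_sequence h A b f \<mu> x0 xs" for xs
  proof
    fix k
    show "xs k = X k"
    proof (induction k)
      case 0
      then show ?case using that by (simp add: prox_sequence_def X_def x0)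
    next
      case (Suc k)
      then show ?case using that prox[of k] unfolding prox_sequence_def by (metis singletonD)
    qed
  qed
  have "\<exists>!xs. prox_sequence h A b f \<mu> x0 xs"
    using X uniq by blast
  moreover have "(\<forall>k. \<exists>!y. y \<in> prox_argmin h A b f (\<mu> k) (xs k)) \<and> (\<forall>k\<ge>1. xs k = X k)"
    if "prox_sequence h A b f \<mu> x0 xs" for xs
    unfolding uniq[OF that] by (simp add: prox)
  ultimately show ?thesis
    unfolding X_def[symmetric] by (simp add: visc)
qed

end
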